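(* For each integer $m\ge1$ let $X^{(m)}_1,X^{(m)}_2,\dots$ be i.i.d. random variables with beta$(1,m)$ distribution, let $S^{(m)}_n=X^{(m)}_1+\dots+X^{(m)}_n$ for $n\ge1$, and let $$L_{\infty,m}=\sum_{k=1}^\infty 1\left[S^{(m)}_k\le1\right].$$ Then, as $m\to\infty$, the random variable $(L_{\infty,m}-m)/\sqrt m$ converges in distribution to the Gaussian distribution with mean $0$ and variance $1$.
   Context: The beta$(1,m)$ distribution has density $m(1-x)^{m-1}$ on $(0,1)$. $1[\cdot]$ denotes the indicator of an event. *)

theory Defs
  imports "HOL-Probability.Probability"
begin

definition beta1_density :: "nat \<Rightarrow> real \<Rightarrow> real" where
  "beta1_density m x = real m * (1 - x) ^ (m - 1) * indicator {0<..<1} x"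

definition partial_sum :: "(nat \<Rightarrow> 'a \<Rightarrow> real) \<Rightarrow> nat \<Rightarrow> 'a \<Rightarrow> real" where
  "partial_sum X n \<omega> = (\<Sum>i=1..n. X i \<omega>)"

text \<open>The sum runs over the indices \<open>k + 1 \<ge> 1\<close>. It may be infinite on a null set,
  hence the value in \<^typ>\<open>ennreal\<close>.\<close>

definition L_infty :: "(nat \<Rightarrow> 'a \<Rightarrow> real) \<Rightarrow> 'a \<Rightarrow> ennreal" where
  "L_infty X \<omega> = (\<Sum>k. indicator {\<omega>'. partial_sum X (Suc k) \<omega>' \<le> 1} \<omega>)"

end

theory Submission
  imports Defs "HOL-Real_Asymp.Real_Asymp"
begin

text \<open>
  Almost surely the summands are positive, so the partial sums \<open>S\<^sub>k\<close> increase, and they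
  eventually exceed 1. Then \<open>L\<^sub>\<infinity>\<close> is the number of partial sums up to 1, and
  \<open>L\<^sub>\<infinity> \<le> z\<close> for \<open>z \<ge> 0\<close> holds exactly when \<open>S\<^sub>n > 1\<close> for
  \<open>n = \<lfloor>z\<rfloor> + 1\<close> (lemma \<open>prob_L_infty_le\<close>). This turns the distribution function of
  \<open>L\<^sub>\<infinity>\<close> into that of a sum of \<open>n\<close> independent variables.

  Fix \<open>t\<close> and put \<open>z = m + t * sqrt m\<close>. The beta(1,m) distribution has mean \<open>1/(m+1)\<close>,
  variance asymptotic to \<open>1/m\<^sup>2\<close> and third absolute central moment of order \<open>1/m\<^sup>3\<close>.
  Hence \<open>sqrt m * (S\<^sub>n - n/(m+1))\<close>, with \<open>n\<close> asymptotic to \<open>m\<close>, is a row sum of a triangular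
  array satisfying Lyapunov's condition with limiting variance 1. As
  \<open>sqrt m * (n/(m+1) - 1)\<close> tends to \<open>t\<close>, the variable \<open>sqrt m * (S\<^sub>n - 1) - t\<close> is
  asymptotically standard normal, so \<open>P(S\<^sub>n \<le> 1)\<close>, the value of its distribution function at
  \<open>-t\<close>, tends to \<open>\<Phi>(-t) = 1 - \<Phi>(t)\<close>.

  The central limit theorem for triangular arrays (lemma \<open>lyapunov_triangular_array\<close>) follows
  from Levy's continuity theorem and the second-order expansion of characteristic functions.
\<close>

section \<open>Moments of the beta(1,m) distribution\<close>

lemma has_bochner_integral_beta1_density_power:
  assumes "m \<ge> 1"
  shows "has_bochner_integral lborel (\<lambda>x. beta1_density m x * x ^ k)
           (fact k * fact m / fact (m + k))"
proof -
  let ?f = "\<lambda>x::real. indicator {0..1} x *\<^sub>R (x powr (real (k+1) - 1) * (1-x) powr (real m - 1))"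
  have si: "set_integrable lborel {0..1} (\<lambda>x. x powr (real (k+1) - 1) * (1-x) powr (real m - 1))"
    by (rule integrable_Beta) (use assms in auto)
  have "integral\<^sup>L lborel ?f = Beta (real (k+1)) (real m)"
    using set_borel_integral_eq_integral(2)[OF si]
      integral_unique[OF has_integral_Beta_real[of "real (k+1)" "real m"]] assms
    by (simp add: set_lebesgue_integral_def)
  also have "\<dots> = fact k * fact (m - 1) / fact (m + k)"
    using assms Gamma_fact[of k, where 'a=real] Gamma_fact[of "m - 1", where 'a=real]
      Gamma_fact[of "m + k", where 'a=real]
    by (simp add: Beta_def add_ac of_nat_diff)
  finally have "has_bochner_integral lborel ?f (fact k * fact (m - 1) / fact (m + k))"
    using si by (simp add: has_bochner_integral_iff set_integrable_def)
  then have "has_bochner_integral lborel (\<lambda>x. real m * ?f x)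
      (real m * (fact k * fact (m - 1) / fact (m + k)))"
    by (rule has_bochner_integral_mult_right)
  moreover have "real m * (fact k * fact (m - 1) / fact (m + k)) = fact k * fact m / fact (m + k)"
    using assms fact_reduce[of m, where 'a=real] by simp
  \<comment> \<open>Powers and \<open>powr\<close> may disagree at the end points, since \<open>0 powr 0 = 0\<close>.\<close>
  moreover have "AE x in lborel. real m * ?f x = beta1_density m x * x ^ k"
    using AE_lborel_singleton[of "0::real"] AE_lborel_singleton[of "1::real"]
  proof eventually_elim
    case (elim x)
    show ?case
    proof (cases "0 < x \<and> x < 1")
      case True
      then have "(1 - x) powr (real m - 1) = (1 - x) ^ (m - 1)"
        using assms powr_realpow[of "1 - x" "m - 1"] by (simp add: of_nat_diff)
      with True show ?thesis
        by (simp add: beta1_density_def powr_realpow)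
    qed (use elim in \<open>auto simp: beta1_density_def indicator_def\<close>)
  qed
  moreover have "(\<lambda>x. beta1_density m x * x ^ k) \<in> borel_measurable lborel"
    by (simp add: beta1_density_def[abs_def])
  moreover have "(\<lambda>x. real m * ?f x) \<in> borel_measurable lborel"
    by measurable
  ultimately show ?thesis
    using has_bochner_integral_cong_AE[of "\<lambda>x. real m * ?f x" lborel
        "\<lambda>x. beta1_density m x * x ^ k"] by (simp only:)
qed

lemma beta1_density_nonneg: "0 \<le> beta1_density m x"
  by (simp add: beta1_density_def indicator_def)

context prob_space
begin

context
  fixes X :: "'a \<Rightarrow> real" and m :: nat
  assumes m: "m \<ge> 1"
    and X: "distributed M lborel X (\<lambda>x. ennreal (beta1_density m x))"
begin

lemma beta1_integrable_power: "integrable M (\<lambda>\<omega>. X \<omega> ^ k)"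
  using has_bochner_integral_beta1_density_power[OF m, of k]
    distributed_integrable[OF X, of "\<lambda>x. x ^ k"]
  by (simp add: beta1_density_nonneg has_bochner_integral_iff)

lemma beta1_expectation_power: "expectation (\<lambda>\<omega>. X \<omega> ^ k) = fact k * fact m / fact (m + k)"
  using has_bochner_integral_beta1_density_power[OF m, of k]
    distributed_integral[OF X, of "\<lambda>x. x ^ k"]
  by (simp add: beta1_density_nonneg has_bochner_integral_iff)

lemma beta1_AE_in_unit_interval: "AE \<omega> in M. 0 < X \<omega> \<and> X \<omega> < 1"
  by (subst distributed_AE2[OF X]) (auto simp: beta1_density_def indicator_def)

lemma beta1_measurable: "X \<in> borel_measurable M"
  using distributed_measurable[OF X] by simp

lemma beta1_first_moments:
  "expectation X = 1 / (real m + 1)"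
  "expectation (\<lambda>\<omega>. X \<omega> ^ 2) = 2 / ((real m + 1) * (real m + 2))"
  "expectation (\<lambda>\<omega>. X \<omega> ^ 3) = 6 / ((real m + 1) * (real m + 2) * (real m + 3))"
proof -
  have f1: "fact (m + 1) = (real m + 1) * fact m"
    by simp
  have f2: "fact (m + 2) = (real m + 1) * (real m + 2) * fact m"
    using fact_Suc[of "m + 1", where 'a=real] f1 by (simp add: algebra_simps)
  have f3: "fact (m + 3) = (real m + 1) * (real m + 2) * (real m + 3) * fact m"
    using fact_Suc[of "m + 2", where 'a=real] f2 by (simp add: algebra_simps numeral_3_eq_3)
  show "expectation X = 1 / (real m + 1)"
    using beta1_expectation_power[of 1] unfolding f1 by simp
  show "expectation (\<lambda>\<omega>. X \<omega> ^ 2) = 2 / ((real m + 1) * (real m + 2))"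
    using beta1_expectation_power[of 2] unfolding f2 by simp
  show "expectation (\<lambda>\<omega>. X \<omega> ^ 3) = 6 / ((real m + 1) * (real m + 2) * (real m + 3))"
    using beta1_expectation_power[of 3] unfolding f3 by (simp add: fact_numeral)
qed

lemma beta1_integrable_exp_uminus: "integrable M (\<lambda>\<omega>. exp (- X \<omega>))"
  using beta1_measurable beta1_AE_in_unit_interval
  by (intro integrable_const_bound[where B = 1]) auto

lemma beta1_expectation_exp_uminus_le:
  "expectation (\<lambda>\<omega>. exp (- X \<omega>)) \<le> 1 - 1 / (2 * (real m + 1))"
proof -
  have bound: "exp (- x) \<le> 1 - x / 2" if "0 < x" "x < 1" for x :: real
  proof -
    have "1 \<le> (1 - x / 2) * (1 + x)"
      using that mult_nonneg_nonneg[of x "1 - x"] by (simp add: algebra_simps)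
    also have "\<dots> \<le> (1 - x / 2) * exp x"
      using that by (intro mult_left_mono exp_ge_add_one_self) auto
    finally show ?thesis
      by (simp add: exp_minus field_simps)
  qed
  have [simp]: "integrable M X"
    using beta1_integrable_power[of 1] by simp
  have "expectation (\<lambda>\<omega>. exp (- X \<omega>)) \<le> expectation (\<lambda>\<omega>. 1 - X \<omega> / 2)"
    using beta1_AE_in_unit_interval bound beta1_integrable_exp_uminus
    by (intro integral_mono_AE) auto
  also have "\<dots> = 1 - 1 / (2 * (real m + 1))"
    by (simp add: prob_space beta1_first_moments(1))
  finally show ?thesis .
qed

text \<open>The third absolute central moment has the right order \<open>m\<^sup>-\<^sup>3\<close> already by the
  crude bound \<open>\<bar>x - \<mu>\<bar>\<^sup>3 \<le> x\<^sup>3 + \<mu>\<^sup>3\<close>.\<close>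

lemma beta1_central_moments:
  defines "\<mu> \<equiv> 1 / (real m + 1)"
  shows "expectation (\<lambda>\<omega>. X \<omega> - \<mu>) = 0"
    "expectation (\<lambda>\<omega>. (X \<omega> - \<mu>) ^ 2) = 2 / ((real m + 1) * (real m + 2)) - \<mu> ^ 2"
    "integrable M (\<lambda>\<omega>. \<bar>X \<omega> - \<mu>\<bar> ^ 3)"
    "expectation (\<lambda>\<omega>. \<bar>X \<omega> - \<mu>\<bar> ^ 3)
      \<le> 6 / ((real m + 1) * (real m + 2) * (real m + 3)) + \<mu> ^ 3"
proof -
  note [measurable] = beta1_measurable
  have int[simp]: "integrable M X" "integrable M (\<lambda>\<omega>. X \<omega> ^ 2)" "integrable M (\<lambda>\<omega>. X \<omega> ^ 3)"
    using beta1_integrable_power[of 1] beta1_integrable_power[of 2] beta1_integrable_power[of 3]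
    by simp_all
  show "expectation (\<lambda>\<omega>. X \<omega> - \<mu>) = 0"
    by (simp add: prob_space beta1_first_moments(1) \<mu>_def)
  have "expectation (\<lambda>\<omega>. (X \<omega> - \<mu>) ^ 2) = expectation (\<lambda>\<omega>. X \<omega> ^ 2 - 2 * \<mu> * X \<omega> + \<mu> ^ 2)"
    by (simp add: power2_diff algebra_simps)
  also have "\<dots> = 2 / ((real m + 1) * (real m + 2)) - 2 * \<mu> * (1 / (real m + 1)) + \<mu> ^ 2"
    by (simp add: prob_space beta1_first_moments)
  also have "\<dots> = 2 / ((real m + 1) * (real m + 2)) - \<mu> ^ 2"
    by (simp add: \<mu>_def power2_eq_square)
  finally show "expectation (\<lambda>\<omega>. (X \<omega> - \<mu>) ^ 2) = 2 / ((real m + 1) * (real m + 2)) - \<mu> ^ 2" .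
  have bound: "\<bar>x - \<mu>\<bar> ^ 3 \<le> x ^ 3 + \<mu> ^ 3" if "x > 0" for x
  proof -
    have "\<mu> \<ge> 0" by (simp add: \<mu>_def)
    with that have "\<bar>x - \<mu>\<bar> \<le> max x \<mu>" by auto
    then have "\<bar>x - \<mu>\<bar> ^ 3 \<le> max x \<mu> ^ 3" by (intro power_mono) auto
    also have "\<dots> \<le> x ^ 3 + \<mu> ^ 3" using that \<open>\<mu> \<ge> 0\<close> by (auto simp: max_def)
    finally show ?thesis .
  qed
  have ae: "AE \<omega> in M. \<bar>X \<omega> - \<mu>\<bar> ^ 3 \<le> X \<omega> ^ 3 + \<mu> ^ 3"
    using beta1_AE_in_unit_interval by eventually_elim (use bound in blast)
  show int3: "integrable M (\<lambda>\<omega>. \<bar>X \<omega> - \<mu>\<bar> ^ 3)"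
  proof (rule Bochner_Integration.integrable_bound)
    show "integrable M (\<lambda>\<omega>. X \<omega> ^ 3 + \<mu> ^ 3)"
      by simp
    show "AE \<omega> in M. norm (\<bar>X \<omega> - \<mu>\<bar> ^ 3) \<le> norm (X \<omega> ^ 3 + \<mu> ^ 3)"
      using ae by eventually_elim auto
  qed measurable
  have "expectation (\<lambda>\<omega>. \<bar>X \<omega> - \<mu>\<bar> ^ 3) \<le> expectation (\<lambda>\<omega>. X \<omega> ^ 3 + \<mu> ^ 3)"
    using ae int3 by (intro integral_mono_AE) auto
  also have "\<dots> = 6 / ((real m + 1) * (real m + 2) * (real m + 3)) + \<mu> ^ 3"
    by (simp add: prob_space beta1_first_moments)
  finally show "expectation (\<lambda>\<omega>. \<bar>X \<omega> - \<mu>\<bar> ^ 3)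
      \<le> 6 / ((real m + 1) * (real m + 2) * (real m + 3)) + \<mu> ^ 3" .
qed

end

end

section \<open>The counting variable and the partial sums\<close>

text \<open>If the summands are positive and some partial sum exceeds 1, then \<open>L_infty\<close> is the natural number
  \<open>N\<close> for which \<open>N + 1\<close> is the first index of a partial sum exceeding 1.\<close>

lemma L_infty_eq_first_passage:
  assumes pos: "\<And>i. i \<ge> 1 \<Longrightarrow> X i \<omega> > 0"
    and exceeds: "\<exists>n. partial_sum X n \<omega> > 1"
  obtains N where "L_infty X \<omega> = of_nat N"
    and "\<And>k. N \<le> k \<longleftrightarrow> partial_sum X (Suc k) \<omega> > 1"
proof -
  have mono: "partial_sum X i \<omega> \<le> partial_sum X j \<omega>" if "i \<le> j" for i j
    unfolding partial_sum_def
    by (rule sum_mono2) (use that pos in \<open>auto intro: less_imp_le\<close>)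
  define N where "N = (LEAST k. partial_sum X (Suc k) \<omega> > 1)"
  obtain n where n: "partial_sum X n \<omega> > 1"
    using exceeds by blast
  then have "partial_sum X (Suc n) \<omega> > 1"
    using mono[of n "Suc n"] by simp
  then have N: "partial_sum X (Suc N) \<omega> > 1"
    unfolding N_def by (rule LeastI)
  have iff: "N \<le> k \<longleftrightarrow> partial_sum X (Suc k) \<omega> > 1" for k
  proof
    assume "N \<le> k"
    then show "partial_sum X (Suc k) \<omega> > 1"
      using mono[of "Suc N" "Suc k"] N by simp
  qed (simp add: N_def Least_le)
  have "L_infty X \<omega> = (\<Sum>k\<in>{..<N}. indicator {\<omega>'. partial_sum X (Suc k) \<omega>' \<le> 1} \<omega>)"
    unfolding L_infty_def by (rule suminf_finite) (auto simp: indicator_def iff not_less)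
  also have "\<dots> = (\<Sum>k\<in>{..<N}. 1)"
    using iff by (intro sum.cong) (auto simp: indicator_def not_le[symmetric])
  finally show ?thesis
    using that[of N] iff by simp
qed

text \<open>Since \<open>P(S\<^sub>n \<le> 1) \<le> e E(exp(- S\<^sub>n))\<close>, these probabilities decay
  geometrically in \<open>n\<close>; hence \<open>L_infty\<close> is almost surely finite.\<close>

lemma (in prob_space) beta1_partial_sums_exceed:
  assumes m: "m \<ge> 1"
    and indep: "indep_vars (\<lambda>_. borel) X {1..}"
    and X: "\<And>i. i \<ge> 1 \<Longrightarrow> distributed M lborel (X i) (\<lambda>x. ennreal (beta1_density m x))"
  shows "AE \<omega> in M. \<exists>n. partial_sum X n \<omega> > 1"
proof -
  define q where "q = 1 - 1 / (2 * (real m + 1))"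
  have q: "0 \<le> q" "q < 1"
    by (auto simp: q_def field_simps)
  have meas: "X i \<in> borel_measurable M" if "i \<ge> 1" for i
    using beta1_measurable[OF m X[OF that]] .
  have meas_S[measurable]: "partial_sum X n \<in> borel_measurable M" for n
    unfolding partial_sum_def[abs_def] using meas by (intro borel_measurable_sum) auto
  have bound: "prob {\<omega>\<in>space M. partial_sum X n \<omega> \<le> 1} \<le> exp 1 * q ^ n" for n
  proof -
    have ind: "indep_vars (\<lambda>_. borel) (\<lambda>i \<omega>. exp (- X i \<omega>)) {1..n}"
      by (rule indep_vars_compose2[OF indep_vars_subset[OF indep]]) auto
    have int: "integrable M (\<lambda>\<omega>. exp (- X i \<omega>))" if "i \<in> {1..n}" for i
      using that beta1_integrable_exp_uminus[OF m X] by auto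
    have eq: "exp (- partial_sum X n \<omega>) = (\<Prod>i=1..n. exp (- X i \<omega>))" for \<omega>
      by (simp add: partial_sum_def exp_sum sum_negf[symmetric])
    have int_S: "integrable M (\<lambda>\<omega>. exp (- partial_sum X n \<omega>))"
      unfolding eq by (rule indep_vars_integrable[OF _ ind int]) auto
    have "expectation (\<lambda>\<omega>. exp (- partial_sum X n \<omega>)) = (\<Prod>i=1..n. expectation (\<lambda>\<omega>. exp (- X i \<omega>)))"
      unfolding eq by (rule indep_vars_lebesgue_integral[OF _ ind int]) auto
    also have "\<dots> \<le> (\<Prod>i=1..n. q)"
      using beta1_expectation_exp_uminus_le[OF m X]
      by (intro prod_mono) (auto simp: q_def intro!: integral_nonneg_AE)
    finally have le: "expectation (\<lambda>\<omega>. exp (- partial_sum X n \<omega>)) \<le> q ^ n"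
      by simp
    have "prob {\<omega>\<in>space M. partial_sum X n \<omega> \<le> 1}
        = prob {\<omega>\<in>space M. exp (- partial_sum X n \<omega>) \<ge> exp (- 1)}"
      by simp
    also have "\<dots> \<le> expectation (\<lambda>\<omega>. exp (- partial_sum X n \<omega>)) / exp (- 1)"
      by (rule integral_Markov_inequality_measure[where A = "{}", OF int_S]) auto
    also have "\<dots> \<le> q ^ n / exp (- 1)"
      using le by (intro divide_right_mono) auto
    finally show ?thesis
      by (simp add: exp_minus field_simps)
  qed
  have "prob {\<omega>\<in>space M. \<forall>n. partial_sum X n \<omega> \<le> 1} \<le> exp 1 * q ^ n" for n
    using bound[of n] by (elim order_trans[rotated]) (auto intro!: finite_measure_mono)
  moreover have "(\<lambda>n. exp 1 * q ^ n) \<longlonglongrightarrow> 0"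
    using q by (intro tendsto_mult_right_zero LIMSEQ_power_zero) auto
  ultimately have "prob {\<omega>\<in>space M. \<forall>n. partial_sum X n \<omega> \<le> 1} \<le> 0"
    by (intro LIMSEQ_le_const[of _ 0]) blast+
  then have "prob {\<omega>\<in>space M. \<forall>n. partial_sum X n \<omega> \<le> 1} = 0"
    by (simp add: measure_le_0_iff)
  then show ?thesis
    by (subst (asm) prob_eq_0) (auto simp: not_le)
qed

text \<open>Almost sure finiteness matters here, because \<open>enn2real\<close> maps \<open>\<infinity>\<close> to 0.\<close>

lemma (in prob_space) prob_L_infty_le:
  assumes m: "m \<ge> 1"
    and indep: "indep_vars (\<lambda>_. borel) X {1..}"
    and X: "\<And>i. i \<ge> 1 \<Longrightarrow> distributed M lborel (X i) (\<lambda>x. ennreal (beta1_density m x))"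
    and z: "0 \<le> z"
  shows "prob {\<omega>\<in>space M. enn2real (L_infty X \<omega>) \<le> z}
    = 1 - prob {\<omega>\<in>space M. partial_sum X (Suc (nat \<lfloor>z\<rfloor>)) \<omega> \<le> 1}"
proof -
  have meas: "X i \<in> borel_measurable M" if "i \<ge> 1" for i
    using beta1_measurable[OF m X[OF that]] .
  have meas_S[measurable]: "partial_sum X n \<in> borel_measurable M" for n
    unfolding partial_sum_def[abs_def] using meas by (intro borel_measurable_sum) auto
  have [measurable]: "L_infty X \<in> borel_measurable M"
    unfolding L_infty_def[abs_def] by measurable
  have "AE \<omega> in M. \<forall>i\<in>{1..}. 0 < X i \<omega> \<and> X i \<omega> < 1"
    using beta1_AE_in_unit_interval[OF m X]
    by (subst AE_ball_countable) simp_all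
  then have "AE \<omega> in M. enn2real (L_infty X \<omega>) \<le> z \<longleftrightarrow>
      \<not> partial_sum X (Suc (nat \<lfloor>z\<rfloor>)) \<omega> \<le> 1"
    using beta1_partial_sums_exceed[OF m indep X, simplified]
  proof eventually_elim
    case (elim \<omega>)
    obtain N where N: "L_infty X \<omega> = of_nat N"
      "\<And>k. N \<le> k \<longleftrightarrow> partial_sum X (Suc k) \<omega> > 1"
      using elim L_infty_eq_first_passage[of X \<omega>] by auto
    have "enn2real (L_infty X \<omega>) \<le> z \<longleftrightarrow> N \<le> nat \<lfloor>z\<rfloor>"
      using z by (simp add: N(1) enn2real_of_nat le_nat_floor le_nat_iff le_floor_iff)
    then show ?case
      by (simp add: N(2) not_le)
  qed
  then have "prob {\<omega>\<in>space M. enn2real (L_infty X \<omega>) \<le> z}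
      = prob {\<omega>\<in>space M. \<not> partial_sum X (Suc (nat \<lfloor>z\<rfloor>)) \<omega> \<le> 1}"
    by (intro finite_measure_eq_AE) auto
  also have "\<dots> = 1 - prob {\<omega>\<in>space M. partial_sum X (Suc (nat \<lfloor>z\<rfloor>)) \<omega> \<le> 1}"
    by (subst prob_neg) auto
  finally show ?thesis .
qed

section \<open>A central limit theorem for triangular arrays\<close>

text \<open>Lyapunov's theorem for rows of independent centred variables on possibly different
  probability spaces, with a common variance \<open>v j\<close> and a common bound \<open>r j\<close> on
  the third absolute moments in row \<open>j\<close>. A vanishing deterministic shift is allowed.\<close>

lemma lyapunov_triangular_array:
  fixes M :: "nat \<Rightarrow> 'a measure" and Y :: "nat \<Rightarrow> nat \<Rightarrow> 'a \<Rightarrow> real"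
    and n :: "nat \<Rightarrow> nat" and b v r :: "nat \<Rightarrow> real"
  assumes prob: "\<And>j. prob_space (M j)"
    and indep: "\<And>j. prob_space.indep_vars (M j) (\<lambda>_. borel) (Y j) {1..n j}"
    and int3: "\<And>j i. i \<in> {1..n j} \<Longrightarrow> integrable (M j) (\<lambda>\<omega>. \<bar>Y j i \<omega>\<bar> ^ 3)"
    and mean: "\<And>j i. i \<in> {1..n j} \<Longrightarrow> (LINT \<omega>|M j. Y j i \<omega>) = 0"
    and var: "\<And>j i. i \<in> {1..n j} \<Longrightarrow> (LINT \<omega>|M j. (Y j i \<omega>) ^ 2) = v j"
    and third: "\<And>j i. i \<in> {1..n j} \<Longrightarrow> (LINT \<omega>|M j. \<bar>Y j i \<omega>\<bar> ^ 3) \<le> r j"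
    and lim_n: "filterlim n at_top sequentially"
    and lim_v: "(\<lambda>j. real (n j) * v j) \<longlonglongrightarrow> 1"
    and lim_r: "(\<lambda>j. real (n j) * r j) \<longlonglongrightarrow> 0"
    and lim_b: "b \<longlonglongrightarrow> 0"
  shows "weak_conv_m (\<lambda>j. distr (M j) borel (\<lambda>\<omega>. (\<Sum>i=1..n j. Y j i \<omega>) + b j))
           std_normal_distribution"
proof (rule levy_continuity)
  note [simp del] = One_nat_def
  interpret prob_space "M j" for j by (rule prob)
  have meas: "Y j i \<in> borel_measurable (M j)" if "i \<in> {1..n j}" for i j
    using indep[of j] that by (auto simp: indep_vars_def2)
  have meas_sum[measurable]: "(\<lambda>\<omega>. \<Sum>i=1..n j. Y j i \<omega>) \<in> borel_measurable (M j)" for j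
    using meas by (intro borel_measurable_sum) auto
  show "real_distribution (distr (M j) borel (\<lambda>\<omega>. (\<Sum>i=1..n j. Y j i \<omega>) + b j))" for j
    by (intro real_distribution_distr) measurable
  show "real_distribution std_normal_distribution"
    by (rule real_dist_normal_dist)
  fix t :: real
  \<comment> \<open>Compare each factor with the characteristic function \<open>w j\<close> of the normal distribution of
    variance \<open>v j\<close>; the error \<open>e j\<close> satisfies \<open>n j * e j \<longlonglongrightarrow> 0\<close>.\<close>
  define \<phi> where "\<phi> j i = char (distr (M j) borel (Y j i)) t" for j i
  define w where "w j = exp (- (t\<^sup>2 * v j / 2))" for j
  define e where "e j = \<bar>t\<bar> ^ 3 / 6 * r j + (t\<^sup>2 * v j / 2)\<^sup>2" for j
  have char_eq: "char (distr (M j) borel (\<lambda>\<omega>. (\<Sum>i=1..n j. Y j i \<omega>) + b j)) t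
      = (\<Prod>i=1..n j. \<phi> j i) * iexp (t * b j)" for j
  proof -
    have "char (distr (M j) borel (\<lambda>\<omega>. (\<Sum>i=1..n j. Y j i \<omega>) + b j)) t
        = (CLINT \<omega>|M j. iexp (t * (\<Sum>i=1..n j. Y j i \<omega>)) * iexp (t * b j))"
      unfolding char_def
      by (subst integral_distr) (auto simp: exp_add[symmetric] algebra_simps)
    also have "\<dots> = char (distr (M j) borel (\<lambda>\<omega>. \<Sum>i=1..n j. Y j i \<omega>)) t * iexp (t * b j)"
      unfolding char_def by (subst integral_distr) auto
    finally show ?thesis
      by (simp add: char_distr_sum[OF indep] \<phi>_def)
  qed
  have v_nonneg: "v j \<ge> 0" if "n j \<ge> 1" for j
  proof -
    have "0 \<le> (LINT \<omega>|M j. (Y j 1 \<omega>)\<^sup>2)"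
      by (rule Bochner_Integration.integral_nonneg) simp
    then show ?thesis
      using var[of 1 j] that by simp
  qed
  have approx: "norm (\<phi> j i - w j) \<le> e j" if i: "i \<in> {1..n j}" for j i
  proof -
    have [measurable]: "Y j i \<in> borel_measurable (M j)"
      by (rule meas[OF i])
    have int2: "integrable (M j) (\<lambda>\<omega>. (Y j i \<omega>)\<^sup>2)"
    proof (rule Bochner_Integration.integrable_bound)
      show "integrable (M j) (\<lambda>\<omega>. 1 + \<bar>Y j i \<omega>\<bar> ^ 3)"
        using int3[OF i] by simp
      have "x\<^sup>2 \<le> 1 + \<bar>x\<bar> ^ 3" for x :: real
      proof (cases "\<bar>x\<bar> \<le> 1")
        case True
        then have "x\<^sup>2 \<le> 1" by (simp add: abs_square_le_1)
        then show ?thesis by (simp add: add_increasing2)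
      next
        case False
        then have "\<bar>x\<bar> ^ 2 \<le> \<bar>x\<bar> ^ 3" by (intro power_increasing) auto
        then show ?thesis by simp
      qed
      then show "AE \<omega> in M j. norm ((Y j i \<omega>)\<^sup>2) \<le> norm (1 + \<bar>Y j i \<omega>\<bar> ^ 3)"
        by (intro always_eventually) (auto simp: add_nonneg_nonneg)
    qed measurable
    have int1: "integrable (M j) (Y j i)"
      by (rule square_integrable_imp_integrable[OF _ int2]) measurable
    have "norm (\<phi> j i - (1 - t^2 * v j / 2))
        \<le> t^2 / 6 * (LINT \<omega>|M j. min (6 * (Y j i \<omega>)^2) (\<bar>t\<bar> * \<bar>Y j i \<omega>\<bar> ^ 3))"
      unfolding \<phi>_def
      by (rule char_approx3'[OF _ int1 int2]) (use mean[OF i] var[OF i] in auto)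
    also have "\<dots> \<le> t^2 / 6 * (LINT \<omega>|M j. \<bar>t\<bar> * \<bar>Y j i \<omega>\<bar> ^ 3)"
      using int3[OF i] int2
      by (intro mult_left_mono integral_mono integrable_min integrable_mult_right) auto
    also have "\<dots> \<le> t^2 / 6 * (\<bar>t\<bar> * r j)"
      using third[OF i] by (auto intro!: mult_left_mono)
    also have "\<dots> = \<bar>t\<bar> ^ 3 / 6 * r j"
      by (simp add: power3_eq_cube power2_eq_square)
    finally have 1: "norm (\<phi> j i - (1 - t^2 * v j / 2)) \<le> \<bar>t\<bar> ^ 3 / 6 * r j" .
    define x where "x = t\<^sup>2 * v j / 2"
    have "x \<ge> 0"
      using v_nonneg[of j] i by (auto simp: x_def)
    have "\<bar>(1 - x) - exp (- x)\<bar> \<le> x\<^sup>2"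
    proof -
      have "1 - x \<le> exp (- x)"
        using exp_ge_add_one_self[of "- x"] by simp
      moreover have "exp (- x) \<le> 1 / (1 + x)"
        using \<open>x \<ge> 0\<close> exp_ge_add_one_self[of x] by (simp add: exp_minus field_simps)
      moreover have "1 / (1 + x) \<le> 1 - x + x\<^sup>2"
        using \<open>x \<ge> 0\<close> by (simp add: field_simps power2_eq_square)
      ultimately show ?thesis by simp
    qed
    then have 2: "norm (complex_of_real (1 - x) - complex_of_real (exp (- x))) \<le> x\<^sup>2"
      unfolding of_real_diff[symmetric] norm_of_real .
    show ?thesis
      using norm_triangle_le[OF add_mono[OF 1 2[unfolded x_def]]]
      by (simp add: w_def e_def)
  qed
  have diff: "norm ((\<Prod>i=1..n j. \<phi> j i) - exp (- (t\<^sup>2 / 2 * (real (n j) * v j)))) \<le> real (n j) * e j"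
    if "n j \<ge> 1" for j
  proof -
    have le1: "norm (complex_of_real (w j)) \<le> 1"
      using v_nonneg[OF that] unfolding norm_of_real w_def by simp
    have "exp (- (t\<^sup>2 / 2 * (real (n j) * v j))) = (\<Prod>i=1..n j. w j)"
      by (simp add: w_def exp_of_nat_mult[symmetric] algebra_simps)
    then have "norm ((\<Prod>i=1..n j. \<phi> j i) - exp (- (t\<^sup>2 / 2 * (real (n j) * v j))))
        = norm ((\<Prod>i=1..n j. \<phi> j i) - (\<Prod>i=1..n j. complex_of_real (w j)))"
      by simp
    also have "\<dots> \<le> (\<Sum>i=1..n j. norm (\<phi> j i - w j))"
    proof (rule norm_prod_diff)
      fix i assume "i \<in> {1..n j}"
      then interpret Y: real_distribution "distr (M j) borel (Y j i)"
        by (intro real_distribution_distr meas)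
      show "norm (\<phi> j i) \<le> 1" unfolding \<phi>_def by (rule Y.cmod_char_le_1)
    qed (rule le1)
    also have "\<dots> \<le> (\<Sum>i=1..n j. e j)"
      by (intro sum_mono approx)
    finally show ?thesis by simp
  qed
  have n1: "\<forall>\<^sub>F j in sequentially. n j \<ge> 1"
    using lim_n by (simp add: filterlim_at_top)
  \<comment> \<open>The square of \<open>v j\<close> is negligible because \<open>n v\<^sup>2 = (n v)\<^sup>2 / n\<close>.\<close>
  have inv_n: "(\<lambda>j. 1 / real (n j)) \<longlonglongrightarrow> 0"
    using filterlim_compose[OF filterlim_real_sequentially lim_n]
    by (intro tendsto_divide_0[OF tendsto_const] filterlim_at_top_imp_at_infinity)
  have "(\<lambda>j. \<bar>t\<bar> ^ 3 / 6 * (real (n j) * r j)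
      + (t\<^sup>2 / 2)\<^sup>2 * ((real (n j) * v j)\<^sup>2 * (1 / real (n j)))) \<longlonglongrightarrow>
      \<bar>t\<bar> ^ 3 / 6 * 0 + (t\<^sup>2 / 2)\<^sup>2 * (1\<^sup>2 * 0)"
    by (intro tendsto_intros lim_r lim_v inv_n)
  then have "(\<lambda>j. \<bar>t\<bar> ^ 3 / 6 * (real (n j) * r j)
      + (t\<^sup>2 / 2)\<^sup>2 * ((real (n j) * v j)\<^sup>2 * (1 / real (n j)))) \<longlonglongrightarrow> 0"
    by simp
  moreover have "\<forall>\<^sub>F j in sequentially. \<bar>t\<bar> ^ 3 / 6 * (real (n j) * r j)
      + (t\<^sup>2 / 2)\<^sup>2 * ((real (n j) * v j)\<^sup>2 * (1 / real (n j))) = real (n j) * e j"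
    using n1 by eventually_elim (simp add: e_def field_simps power2_eq_square)
  ultimately have "(\<lambda>j. real (n j) * e j) \<longlonglongrightarrow> 0"
    by (rule Lim_transform_eventually)
  moreover have "\<forall>\<^sub>F j in sequentially. norm ((\<Prod>i=1..n j. \<phi> j i)
      - exp (- (t\<^sup>2 / 2 * (real (n j) * v j)))) \<le> real (n j) * e j"
    using n1 by eventually_elim (rule diff)
  ultimately have "(\<lambda>j. (\<Prod>i=1..n j. \<phi> j i) - exp (- (t\<^sup>2 / 2 * (real (n j) * v j)))) \<longlonglongrightarrow> 0"
    by (rule Lim_null_comparison[rotated])
  moreover have "(\<lambda>j. complex_of_real (exp (- (t\<^sup>2 / 2 * (real (n j) * v j)))))
      \<longlonglongrightarrow> complex_of_real (exp (- (t\<^sup>2 / 2 * 1)))"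
    by (intro tendsto_intros lim_v)
  ultimately have "(\<lambda>j. \<Prod>i=1..n j. \<phi> j i) \<longlonglongrightarrow> complex_of_real (exp (- (t\<^sup>2 / 2 * 1)))"
    by (rule Lim_transform[rotated])
  moreover have "(\<lambda>j. iexp (t * b j)) \<longlonglongrightarrow> iexp (t * 0)"
    by (intro tendsto_intros lim_b)
  ultimately have "(\<lambda>j. (\<Prod>i=1..n j. \<phi> j i) * iexp (t * b j))
      \<longlonglongrightarrow> complex_of_real (exp (- (t\<^sup>2 / 2 * 1))) * iexp (t * 0)"
    by (rule tendsto_mult)
  then show "(\<lambda>j. char (distr (M j) borel (\<lambda>\<omega>. (\<Sum>i=1..n j. Y j i \<omega>) + b j)) t)
      \<longlonglongrightarrow> char std_normal_distribution t"
    by (simp add: char_eq char_std_normal_distribution)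
qed

section \<open>The limit law\<close>

lemma measure_std_normal_singleton: "measure std_normal_distribution {x} = 0"
  by (simp add: measure_def emeasure_density nn_integral_null_delta)

lemma cdf_std_normal_uminus:
  "cdf std_normal_distribution (- x) = 1 - cdf std_normal_distribution x"
proof -
  interpret N: real_distribution std_normal_distribution
    by (rule real_dist_normal_dist)
  have "distributed std_normal_distribution lborel (\<lambda>x. x) std_normal_density"
    by (auto simp: distributed_def distr_id2 intro!: distr_id2)
  then have "distributed std_normal_distribution lborel (\<lambda>x. - x) std_normal_density"
    using N.normal_density_affine[of "\<lambda>x. x" 0 1 "-1" 0] by simp
  then have "distr std_normal_distribution lborel (\<lambda>x. - x) = std_normal_distribution"
    by (rule distributed_distr_eq_density)
  then have "cdf std_normal_distribution (- x)
      = measure (distr std_normal_distribution lborel uminus) {..- x}"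
    by (simp add: cdf_def)
  also have "\<dots> = N.prob (uminus -` {..- x})"
    by (subst measure_distr) auto
  also have "uminus -` {..- x} = {x..}"
    by auto
  also have "{x..} = UNIV - ({..x} - {x})"
    by auto
  also have "N.prob \<dots> = 1 - (N.prob {..x} - N.prob {x})"
    using N.prob_compl[of "{..x} - {x}"] by (simp add: N.finite_measure_Diff)
  finally show ?thesis
    by (simp add: cdf_def measure_std_normal_singleton)
qed

theorem proposition5p13:
  fixes M :: "nat \<Rightarrow> 'a measure"
    and X :: "nat \<Rightarrow> nat \<Rightarrow> 'a \<Rightarrow> real"
  assumes "\<And>m. m \<ge> 1 \<Longrightarrow> prob_space (M m)"
    and "\<And>m. m \<ge> 1 \<Longrightarrow> prob_space.indep_vars (M m) (\<lambda>_. borel) (X m) {1..}"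
    and "\<And>m i. m \<ge> 1 \<Longrightarrow> i \<ge> 1 \<Longrightarrow> distributed (M m) lborel (X m i) (\<lambda>x. ennreal (beta1_density m x))"
  shows "weak_conv_m
    (\<lambda>m. distr (M m) borel (\<lambda>\<omega>. (enn2real (L_infty (X m) \<omega>) - real m) / sqrt (real m)))
    std_normal_distribution"
  unfolding weak_conv_m_def weak_conv_def
proof (intro allI impI)
  note [simp del] = One_nat_def
  fix t :: real
  \<comment> \<open>Nothing is assumed for \<open>m = 0\<close>, so the sequences are indexed by \<open>j\<close> with
    \<open>m = Suc j\<close>.\<close>
  define n where "n j = Suc (nat \<lfloor>real (Suc j) + t * sqrt (Suc j)\<rfloor>)" for j
  define \<mu> where "\<mu> j = 1 / (real (Suc j) + 1)" for j
  define Y where "Y j i \<omega> = sqrt (Suc j) * (X (Suc j) i \<omega> - \<mu> j)" for j i \<omega>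
  define b where "b j = sqrt (Suc j) * (real (n j) * \<mu> j - 1) - t" for j
  define v where "v j = real (Suc j) * (2 / ((real (Suc j) + 1) * (real (Suc j) + 2)) - \<mu> j ^ 2)" for j
  define r where "r j = sqrt (Suc j) ^ 3 *
    (6 / ((real (Suc j) + 1) * (real (Suc j) + 2) * (real (Suc j) + 3)) + \<mu> j ^ 3)" for j
  interpret prob_space "M (Suc j)" for j
    by (rule assms) simp
  interpret N: real_distribution std_normal_distribution
    by (rule real_dist_normal_dist)
  have X: "distributed (M (Suc j)) lborel (X (Suc j) i) (\<lambda>x. ennreal (beta1_density (Suc j) x))"
    if "i \<ge> 1" for i j
    using assms(3)[of "Suc j" i] that by simp
  have indep: "indep_vars j (\<lambda>_. borel) (X (Suc j)) {1..}" for j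
    using assms(2)[of "Suc j"] by simp
  have meas_S[measurable]: "partial_sum (X (Suc j)) k \<in> borel_measurable (M (Suc j))" for j k
    unfolding partial_sum_def[abs_def]
    using beta1_measurable[OF _ X] by (intro borel_measurable_sum) auto
  have [measurable]: "L_infty (X (Suc j)) \<in> borel_measurable (M (Suc j))" for j
    unfolding L_infty_def[abs_def] by measurable

  have ev: "\<forall>\<^sub>F j in sequentially. 0 \<le> real (Suc j) + t * sqrt (Suc j)"
    by real_asymp
  \<comment> \<open>All limits use only \<open>n j = m + t * sqrt m + O(1)\<close>.\<close>
  have lim_n: "filterlim n at_top sequentially"
    unfolding n_def by real_asymp
  have lim_v: "(\<lambda>j. real (n j) * v j) \<longlonglongrightarrow> 1"
    unfolding n_def v_def \<mu>_def by real_asymp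
  have lim_r: "(\<lambda>j. real (n j) * r j) \<longlonglongrightarrow> 0"
    unfolding n_def r_def \<mu>_def by real_asymp
  have lim_b: "b \<longlonglongrightarrow> 0"
    unfolding b_def[abs_def] n_def \<mu>_def by real_asymp

  have sum_eq: "(\<Sum>i=1..n j. Y j i \<omega>) + b j = sqrt (Suc j) * (partial_sum (X (Suc j)) (n j) \<omega> - 1) - t"
    for j \<omega>
    by (simp add: Y_def b_def partial_sum_def sum_distrib_left[symmetric] sum_subtractf algebra_simps)
  have "weak_conv_m (\<lambda>j. distr (M (Suc j)) borel (\<lambda>\<omega>. (\<Sum>i=1..n j. Y j i \<omega>) + b j))
      std_normal_distribution"
  proof (rule lyapunov_triangular_array[OF _ _ _ _ _ _ lim_n lim_v lim_r lim_b])
    show "prob_space (M (Suc j))" for j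
      by unfold_locales
    show "indep_vars j (\<lambda>_. borel) (Y j) {1..n j}" for j
      unfolding Y_def[abs_def]
      by (rule indep_vars_compose2[OF indep_vars_subset[OF indep]]) auto
    fix j i assume "i \<in> {1..n j}"
    then have "i \<ge> 1" by simp
    note cm = beta1_central_moments[OF _ X[OF this], of j, simplified, folded \<mu>_def]
    show "integrable (M (Suc j)) (\<lambda>\<omega>. \<bar>Y j i \<omega>\<bar> ^ 3)"
      using cm by (simp add: Y_def abs_mult power_mult_distrib \<mu>_def)
    show "(LINT \<omega>|M (Suc j). Y j i \<omega>) = 0"
      using cm by (simp add: Y_def \<mu>_def)
    show "(LINT \<omega>|M (Suc j). (Y j i \<omega>) ^ 2) = v j"
      using cm by (simp add: Y_def power_mult_distrib v_def \<mu>_def)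
    show "(LINT \<omega>|M (Suc j). \<bar>Y j i \<omega>\<bar> ^ 3) \<le> r j"
      using cm by (simp add: Y_def abs_mult power_mult_distrib r_def \<mu>_def)
  qed
  then have "(\<lambda>j. cdf (distr (M (Suc j)) borel (\<lambda>\<omega>. (\<Sum>i=1..n j. Y j i \<omega>) + b j)) (- t))
      \<longlonglongrightarrow> cdf std_normal_distribution (- t)"
    unfolding weak_conv_m_def weak_conv_def
    using N.isCont_cdf measure_std_normal_singleton by blast
  moreover have "cdf (distr (M (Suc j)) borel (\<lambda>\<omega>. (\<Sum>i=1..n j. Y j i \<omega>) + b j)) (- t)
      = prob j {\<omega>\<in>space (M (Suc j)). partial_sum (X (Suc j)) (n j) \<omega> \<le> 1}" for j
    unfolding sum_eq cdf_def
    by (subst measure_distr) (auto intro!: arg_cong[where f = "prob j"] simp: mult_le_0_iff)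
  ultimately have "(\<lambda>j. 1 - prob j {\<omega>\<in>space (M (Suc j)). partial_sum (X (Suc j)) (n j) \<omega> \<le> 1})
      \<longlonglongrightarrow> 1 - cdf std_normal_distribution (- t)"
    by (intro tendsto_diff tendsto_const) simp
  moreover have "\<forall>\<^sub>F j in sequentially.
      1 - prob j {\<omega>\<in>space (M (Suc j)). partial_sum (X (Suc j)) (n j) \<omega> \<le> 1}
      = cdf (distr (M (Suc j)) borel
          (\<lambda>\<omega>. (enn2real (L_infty (X (Suc j)) \<omega>) - real (Suc j)) / sqrt (real (Suc j)))) t"
    using ev
  proof eventually_elim
    case (elim j)
    have "cdf (distr (M (Suc j)) borel
          (\<lambda>\<omega>. (enn2real (L_infty (X (Suc j)) \<omega>) - real (Suc j)) / sqrt (real (Suc j)))) t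
      = prob j {\<omega>\<in>space (M (Suc j)). enn2real (L_infty (X (Suc j)) \<omega>) \<le> real (Suc j) + t * sqrt (Suc j)}"
      unfolding cdf_def
      by (subst measure_distr)
         (auto intro!: arg_cong[where f = "prob j"] simp: divide_le_eq)
    also have "\<dots> = 1 - prob j {\<omega>\<in>space (M (Suc j)). partial_sum (X (Suc j)) (n j) \<omega> \<le> 1}"
      unfolding n_def by (rule prob_L_infty_le[OF _ indep X elim]) auto
    finally show ?case by simp
  qed
  ultimately have "(\<lambda>j. cdf (distr (M (Suc j)) borel
      (\<lambda>\<omega>. (enn2real (L_infty (X (Suc j)) \<omega>) - real (Suc j)) / sqrt (real (Suc j)))) t)
      \<longlonglongrightarrow> cdf std_normal_distribution t"
    by (auto simp: cdf_std_normal_uminus intro: Lim_transform_eventually)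
  then show "(\<lambda>m. cdf (distr (M m) borel
      (\<lambda>\<omega>. (enn2real (L_infty (X m) \<omega>) - real m) / sqrt (real m))) t)
      \<longlonglongrightarrow> cdf std_normal_distribution t"
    by (rule LIMSEQ_imp_Suc)
qed

end
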